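(* Consider a point $\bar x\in\mathbb{R}^n$ along with a mapping $f:\mathbb{R}^n\to\mathbb{R}^m$ which is both defined and continuous in a vicinity of $\bar x$. Suppose that there is a surjective linear mapping $A:\mathbb{R}^n\to\mathbb{R}^m$ such that $\mathrm{calm}\,(f-A)(\bar x)<\mathrm{sur}\,A$. Then $n\ge m$ and $$\mathrm{lopen}\,f(\bar x)\ \ge\ \mathrm{sur}\,A-\mathrm{calm}\,(f-A)(\bar x)\ >\ 0.$$
   Context: $\mathbb{R}^n$, $\mathbb{R}^m$ carry Euclidean norms; $\mathbb{B}[u,r]$ is the closed ball. "In a vicinity of $\bar x$" means on some neighborhood of $\bar x$. For a mapping $g$ defined near $\bar x$, the calmness modulus $\mathrm{calm}\,g(\bar x)$ is the infimum of all $\mu>0$ for which there is a neighborhood $U\times V$ of $(\bar x,g(\bar x))$ such that $\|g(x)-g(\bar x)\|\le\mu\|x-\bar x\|$ whenever $x\in U$ and $g(x)\in V$ ($\inf\emptyset=\infty$). $\mathrm{lopen}\,f(\bar x)$ is the supremum of all $c>0$ for which there is $\varepsilon>0$ such that $\mathbb{B}[f(\bar x),ct]\subset f(\mathbb{B}[\bar x,t])$ for each $t\in(0,\varepsilon)$ ($\sup\emptyset=0$). For a continuous linear operator $A$ the modulus of surjection is $\mathrm{sur}\,A=\sup\{\varrho>0: A(\mathbb{B}[0,1])\supset\mathbb{B}[0,\varrho]\}$ (equivalently, the supremum of all $c>0$ such that $\mathbb{B}[Ax,ct]\subset A(\mathbb{B}[x,t])$ for all $x$ and all $t>0$); for a surjective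 matrix $A\in\mathbb{R}^{m\times n}$ this is its least singular value. *)

theory Defs
  imports "HOL-Analysis.Analysis"
begin

text \<open>
  The three moduli are extended real numbers. The infimum of the empty set is \<open>\<infinity>\<close> in
  \<^typ>\<open>ereal\<close>; for the suprema, \<open>0\<close> is inserted because the supremum of the empty set is taken to
  be \<open>0\<close>, whereas \<^typ>\<open>ereal\<close> would give \<open>-\<infinity>\<close>.

  A mapping that is only defined near the reference point is represented by any total function
  extending it: \<open>calm g x\<close> and \<open>lopen f x\<close> depend only on the values of the mapping in an
  arbitrarily small neighbourhood of \<open>x\<close>.
\<close>

definition calm :: "('a::real_normed_vector \<Rightarrow> 'b::real_normed_vector) \<Rightarrow> 'a \<Rightarrow> ereal" where
  "calm g x = Inf {ereal \<mu> | \<mu>. \<mu> > 0 \<and>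
     (\<exists>U V. open U \<and> x \<in> U \<and> open V \<and> g x \<in> V \<and>
        (\<forall>u. u \<in> U \<and> g u \<in> V \<longrightarrow> norm (g u - g x) \<le> \<mu> * norm (u - x)))}"

definition lopen :: "('a::real_normed_vector \<Rightarrow> 'b::real_normed_vector) \<Rightarrow> 'a \<Rightarrow> ereal" where
  "lopen f x = Sup (insert 0 {ereal c | c. c > 0 \<and>
     (\<exists>\<epsilon>>0. \<forall>t\<in>{0<..<\<epsilon>}. cball (f x) (c * t) \<subseteq> f ` cball x t)})"

definition sur :: "('a::real_normed_vector \<Rightarrow> 'b::real_normed_vector) \<Rightarrow> ereal" where
  "sur A = Sup (insert 0 {ereal \<rho> | \<rho>. \<rho> > 0 \<and> cball 0 \<rho> \<subseteq> A ` cball 0 1})"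

end

theory Submission
  imports Defs
begin

text \<open>
  Since \<open>A\<close> is onto, the Moore-Penrose inverse \<open>B\<close> sends each \<open>y\<close> to the preimage of \<open>y\<close> under \<open>A\<close>
  of least norm. Hence, if \<open>A\<close> maps the unit ball onto a set containing the ball of radius \<open>\<rho>\<close>, then
  \<open>\<parallel>B y\<parallel> \<le> \<parallel>y\<parallel> / \<rho>\<close>, and \<open>B\<close> is linear, thus continuous; this is
  \<open>linear_right_inverse_of_openness\<close>.

  Let \<open>g = f - A\<close> grow at most at the rate \<open>\<mu> < \<rho>\<close> away from \<open>x\<close>. For a target \<open>y\<close> close to \<open>f x\<close>,
  the equation \<open>f (x + B w) = y\<close> reads \<open>w = (y - f x) - (g (x + B w) - g x)\<close>, because
  \<open>A (B w) = w\<close>. If \<open>\<parallel>y - f x\<parallel> \<le> (\<rho> - \<mu>) t\<close>, the right-hand side maps the ball of radius \<open>\<rho> t\<close>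
  continuously to itself: on that ball \<open>\<parallel>B w\<parallel> \<le> t\<close>, so the norm is at most
  \<open>(\<rho> - \<mu>) t + \<mu> t\<close>. Calmness controls \<open>g\<close> only in comparison with the one point \<open>x\<close>, so this map
  need not be a contraction; a solution comes from Brouwer's fixed point theorem instead
  (\<open>cball_subset_image_of_calm_perturbation\<close>). Letting \<open>\<rho>\<close> tend to \<open>sur A\<close> and \<open>\<mu>\<close> to the calmness
  modulus gives the bound.
\<close>

text \<open>
  The right inverse is \<open>A\<^sup>* (A A\<^sup>*)\<^sup>-\<^sup>1\<close>. Its values lie in the range of the adjoint \<open>A\<^sup>*\<close>, which is
  orthogonal to the kernel of \<open>A\<close>, so they are no longer than any other preimage.
\<close>

lemma linear_right_inverse_of_openness:
  fixes A :: "'a::euclidean_space \<Rightarrow> 'b::euclidean_space"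
  assumes A: "linear A" and "\<rho> > 0" and cover: "cball 0 \<rho> \<subseteq> A ` cball 0 1"
  obtains B where "linear B" "\<And>y. A (B y) = y" "\<And>y. norm (B y) \<le> norm y / \<rho>"
proof -
  have short_preimage: "\<exists>z. A z = y \<and> norm z \<le> norm y / \<rho>" for y
  proof (cases "y = 0")
    case True
    then show ?thesis using linear_0[OF A] by (intro exI[of _ 0]) auto
  next
    case False
    have "(\<rho> / norm y) *\<^sub>R y \<in> cball 0 \<rho>" using False \<open>\<rho> > 0\<close> by simp
    then have "(\<rho> / norm y) *\<^sub>R y \<in> A ` cball 0 1" using cover by blast
    then obtain z where z: "A z = (\<rho> / norm y) *\<^sub>R y" "norm z \<le> 1" by auto
    have "A ((norm y / \<rho>) *\<^sub>R z) = y"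
      using z False \<open>\<rho> > 0\<close> by (simp add: linear_scale[OF A])
    moreover have "norm ((norm y / \<rho>) *\<^sub>R z) \<le> norm y / \<rho>"
      using z(2) \<open>\<rho> > 0\<close> by (simp add: mult_left_le divide_right_mono)
    ultimately show ?thesis by blast
  qed
  let ?T = "adjoint A"
  have T: "linear ?T" by (rule adjoint_linear[OF A])
  have AT: "linear (A \<circ> ?T)" by (rule linear_compose[OF T A])
  have "inj (A \<circ> ?T)"
  proof (rule linear_injective_0[OF AT, THEN iffD2], intro allI impI)
    fix v assume "(A \<circ> ?T) v = 0"
    then have "?T v \<bullet> ?T v = 0" by (simp add: adjoint_works[OF A])
    then have "?T v = 0" by simp
    moreover obtain z where "A z = v" using short_preimage by blast
    ultimately have "v \<bullet> v = 0"
      using adjoint_works[OF A, of z v] by simp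
    then show "v = 0" by simp
  qed
  then obtain h where h: "linear h" "\<And>y. A (?T (h y)) = y"
    using linear_injective_isomorphism[OF AT] by auto
  show thesis
  proof (rule that[of "?T \<circ> h"])
    show "linear (?T \<circ> h)" by (rule linear_compose[OF h(1) T])
    show "A ((?T \<circ> h) y) = y" for y by (simp add: h)
    show "norm ((?T \<circ> h) y) \<le> norm y / \<rho>" for y
    proof -
      obtain z where z: "A z = y" "norm z \<le> norm y / \<rho>" using short_preimage by blast
      have "norm (?T (h y)) * norm (?T (h y)) = ?T (h y) \<bullet> ?T (h y)"
        by (simp add: norm_eq_sqrt_inner)
      also have "\<dots> = z \<bullet> ?T (h y)"
        using h(2) z(1) by (simp add: adjoint_works[OF A])
      also have "\<dots> \<le> norm z * norm (?T (h y))" by (rule norm_cauchy_schwarz)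
      finally have "norm (?T (h y)) \<le> norm z"
        by (cases "?T (h y) = 0") (auto simp: mult_le_cancel_right)
      with z(2) show ?thesis by simp
    qed
  qed
qed

text \<open>
  Brouwer's theorem is applied to the map whose fixed points \<open>w\<close> solve \<open>f (x + B w) = y\<close>. The
  unknown lives in the codomain, so the kernel of \<open>A\<close> does not enter.
\<close>

lemma cball_subset_image_of_calm_perturbation:
  fixes f A :: "'a::euclidean_space \<Rightarrow> 'b::euclidean_space"
  assumes A: "linear A" and "\<rho> > 0" and cover: "cball 0 \<rho> \<subseteq> A ` cball 0 1"
    and "t > 0" and f: "continuous_on (cball x t) f" and "\<mu> \<ge> 0"
    and calm: "\<And>u. u \<in> cball x t \<Longrightarrow>
      norm ((f u - A u) - (f x - A x)) \<le> \<mu> * norm (u - x)"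
  shows "cball (f x) ((\<rho> - \<mu>) * t) \<subseteq> f ` cball x t"
proof
  fix y assume y: "y \<in> cball (f x) ((\<rho> - \<mu>) * t)"
  obtain B where B: "linear B" "\<And>y. A (B y) = y" "\<And>y. norm (B y) \<le> norm y / \<rho>"
    using linear_right_inverse_of_openness[OF A \<open>\<rho> > 0\<close> cover] by blast
  define \<phi> where "\<phi> w = (y - f x) - ((f (x + B w) - A (x + B w)) - (f x - A x))" for w
  have near: "x + B w \<in> cball x t" if "w \<in> cball 0 (\<rho> * t)" for w
  proof -
    have "norm w / \<rho> \<le> t" using that \<open>\<rho> > 0\<close> by (simp add: field_simps)
    then show ?thesis using B(3)[of w] by (simp add: dist_norm)
  qed
  have shift: "continuous_on S (\<lambda>w. x + B w)" for S
    by (intro continuous_intros linear_continuous_on_compose[OF _ B(1)])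
  have "continuous_on (cball 0 (\<rho> * t)) \<phi>"
    unfolding \<phi>_def
    by (intro continuous_intros shift continuous_on_compose2[OF f shift]
        linear_continuous_on_compose[OF shift A]) (use near in auto)
  moreover have "\<phi> w \<in> cball 0 (\<rho> * t)" if w: "w \<in> cball 0 (\<rho> * t)" for w
  proof -
    have "norm (\<phi> w) \<le> norm (y - f x) + norm ((f (x + B w) - A (x + B w)) - (f x - A x))"
      unfolding \<phi>_def by (rule norm_triangle_ineq4)
    also have "\<dots> \<le> (\<rho> - \<mu>) * t + \<mu> * t"
    proof (rule add_mono)
      show "norm (y - f x) \<le> (\<rho> - \<mu>) * t"
        using y by (simp add: dist_norm norm_minus_commute)
      have "norm (B w) \<le> t" using near[OF w] by (simp add: dist_norm)
      then have "\<mu> * norm (B w) \<le> \<mu> * t" using \<open>\<mu> \<ge> 0\<close> by (rule mult_left_mono)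
      with calm[OF near[OF w]]
      show "norm ((f (x + B w) - A (x + B w)) - (f x - A x)) \<le> \<mu> * t" by simp
    qed
    finally show ?thesis by (simp add: algebra_simps)
  qed
  ultimately obtain w where w: "w \<in> cball 0 (\<rho> * t)" "\<phi> w = w"
    by (rule brouwer_ball[OF mult_pos_pos[OF \<open>\<rho> > 0\<close> \<open>t > 0\<close>] _ Pi_I])
  have "f (x + B w) = y"
    using w(2) unfolding \<phi>_def by (simp add: linear_add[OF A] B(2) algebra_simps)
  then show "y \<in> f ` cball x t" using near[OF w(1)] by blast
qed

lemma calm_nonneg: "0 \<le> calm g x"
  unfolding calm_def by (rule Inf_greatest) auto

text \<open>
  A bounded image cannot contain arbitrarily large balls. The argument needs a unit
  vector in the codomain: a map into the zero space covers every ball.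
\<close>

lemma sur_less_top:
  fixes A :: "'a::euclidean_space \<Rightarrow> 'b::euclidean_space"
  assumes "linear A"
  shows "sur A < \<infinity>"
proof -
  have bl: "bounded_linear A" using assms by (simp add: linear_conv_bounded_linear)
  have "\<rho> \<le> onorm A" if "\<rho> > 0" "cball 0 \<rho> \<subseteq> A ` cball 0 1" for \<rho>
  proof -
    obtain b :: 'b where b: "b \<in> Basis" using nonempty_Basis by blast
    have "\<rho> *\<^sub>R b \<in> cball 0 \<rho>" using that b by simp
    then have "\<rho> *\<^sub>R b \<in> A ` cball 0 1" using that(2) by blast
    then obtain z where z: "A z = \<rho> *\<^sub>R b" "norm z \<le> 1" by auto
    have "\<rho> = norm (A z)" using z(1) that b by simp
    also have "\<dots> \<le> onorm A * norm z" by (rule onorm[OF bl])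
    also have "\<dots> \<le> onorm A" using z(2) onorm_pos_le[OF bl] by (simp add: mult_left_le)
    finally show ?thesis .
  qed
  then have "sur A \<le> ereal (onorm A)"
    unfolding sur_def using onorm_pos_le[OF bl] by (intro Sup_least) auto
  then show ?thesis by (rule le_less_trans) simp
qed

text \<open>
  Calmness bounds \<open>g u\<close> only once it is known to be close to \<open>g x\<close>; continuity turns this into a
  condition on \<open>u\<close> alone.
\<close>

lemma calm_less_obtain_rate:
  assumes g: "continuous_on W g" and W: "open W" "x \<in> W" and less: "calm g x < ereal k"
  obtains \<mu> \<delta> where "0 < \<mu>" "\<mu> < k" "0 < \<delta>" "ball x \<delta> \<subseteq> W"
    "\<And>u. u \<in> ball x \<delta> \<Longrightarrow> norm (g u - g x) \<le> \<mu> * norm (u - x)"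
proof -
  obtain \<mu> U V where \<mu>: "\<mu> > 0" "\<mu> < k" and U: "open U" "x \<in> U" and V: "open V" "g x \<in> V"
    and rate: "\<And>u. u \<in> U \<Longrightarrow> g u \<in> V \<Longrightarrow> norm (g u - g x) \<le> \<mu> * norm (u - x)"
    using less unfolding calm_def by (auto simp: Inf_less_iff)
  have "open (g -` V \<inter> W)"
    using g W(1) V(1) by (simp add: continuous_on_open_vimage)
  then have "open (U \<inter> (g -` V \<inter> W))" using U(1) by blast
  moreover have "x \<in> U \<inter> (g -` V \<inter> W)" using U V W by auto
  ultimately obtain \<delta> where "\<delta> > 0" "ball x \<delta> \<subseteq> U \<inter> (g -` V \<inter> W)"
    using open_contains_ball by metis
  then show thesis by (intro that[of \<mu> \<delta>] rate) (use \<mu> in blast)+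
qed

lemma less_sur_obtain_cover:
  assumes "ereal k < sur A" "0 \<le> k"
  obtains \<rho> where "k < \<rho>" "cball 0 \<rho> \<subseteq> A ` cball 0 1"
proof -
  obtain a where "a \<in> insert 0 {ereal \<rho> | \<rho>. \<rho> > 0 \<and> cball 0 \<rho> \<subseteq> A ` cball 0 1}" "ereal k < a"
    using assms(1) unfolding sur_def less_Sup_iff by blast
  then show thesis using assms(2) that by auto
qed

lemma lopen_ge_sur_minus_calm:
  fixes f A :: "'a::euclidean_space \<Rightarrow> 'b::euclidean_space"
  assumes f: "continuous_on W f" and W: "open W" "x \<in> W" and A: "linear A"
    and less: "calm (\<lambda>u. f u - A u) x < sur A"
  shows "sur A - calm (\<lambda>u. f u - A u) x \<le> lopen f x"
proof -
  let ?g = "\<lambda>u. f u - A u"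
  obtain s where s: "sur A = ereal s"
    using sur_less_top[OF A] calm_nonneg[of ?g x] less by (cases "sur A") auto
  obtain k where k: "calm ?g x = ereal k" "0 \<le> k"
    using calm_nonneg[of ?g x] less s by (cases "calm ?g x") auto
  have g: "continuous_on W ?g"
    by (intro continuous_intros f linear_continuous_on_compose[OF continuous_on_id A])
  have below: "ereal c \<le> lopen f x" if c: "0 < c" "c < s - k" for c
  proof -
    \<comment> \<open>Half of the slack \<open>s - k - c\<close> is spent on the rate of \<open>?g\<close>, half on the openness of \<open>A\<close>.\<close>
    define e where "e = (s - k - c) / 2"
    have e: "e > 0" and split: "(s - e) - (k + e) = c" using c by (simp_all add: e_def field_simps)
    have "calm ?g x < ereal (k + e)" using k e by simp
    then obtain \<mu> \<delta> where \<mu>: "0 < \<mu>" "\<mu> < k + e" and \<delta>: "0 < \<delta>" "ball x \<delta> \<subseteq> W"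
      and rate: "\<And>u. u \<in> ball x \<delta> \<Longrightarrow> norm (?g u - ?g x) \<le> \<mu> * norm (u - x)"
      using calm_less_obtain_rate[OF g W] by blast
    have "ereal (s - e) < sur A" "0 \<le> s - e" using s e split c k by simp_all
    then obtain \<rho> where \<rho>: "s - e < \<rho>" "cball 0 \<rho> \<subseteq> A ` cball 0 1"
      by (rule less_sur_obtain_cover)
    have "cball (f x) (c * t) \<subseteq> f ` cball x t" if t: "t \<in> {0<..<\<delta>}" for t
    proof -
      have sub: "cball x t \<subseteq> ball x \<delta>" using t by auto
      have "c \<le> \<rho> - \<mu>" using \<mu> \<rho> split by linarith
      then have "c * t \<le> (\<rho> - \<mu>) * t" using t by (intro mult_right_mono) auto
      then have "cball (f x) (c * t) \<subseteq> cball (f x) ((\<rho> - \<mu>) * t)" by (rule subset_cball)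
      also have "\<dots> \<subseteq> f ` cball x t"
      proof (rule cball_subset_image_of_calm_perturbation[OF A _ \<rho>(2)])
        show "0 < \<rho>" using \<open>0 \<le> s - e\<close> \<rho>(1) by linarith
        show "continuous_on (cball x t) f"
          using f sub \<delta>(2) by (meson continuous_on_subset order_trans)
      qed (use t \<mu> sub rate in auto)
      finally show ?thesis .
    qed
    then have "\<exists>\<epsilon>>0. \<forall>t\<in>{0<..<\<epsilon>}. cball (f x) (c * t) \<subseteq> f ` cball x t"
      using \<delta>(1) by blast
    then have "ereal c \<in> {ereal c | c. c > 0 \<and>
        (\<exists>\<epsilon>>0. \<forall>t\<in>{0<..<\<epsilon>}. cball (f x) (c * t) \<subseteq> f ` cball x t)}"
      using c(1) by simp
    then show ?thesis
      unfolding lopen_def by (intro Sup_upper insertI2)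
  qed
  have "ereal (s - k) \<le> lopen f x" if "0 < s - k"
  proof (rule dense_le_bounded[of 0])
    fix w assume "0 < w" "w < ereal (s - k)"
    then show "w \<le> lopen f x" using below by (cases w) auto
  qed (use that in simp)
  then show ?thesis using less s k by simp
qed

theorem theorem3p4:
  fixes f A :: "real ^ 'n \<Rightarrow> real ^ 'm" and x :: "real ^ 'n"
  assumes "\<exists>U. open U \<and> x \<in> U \<and> continuous_on U f"
    and "linear A" and "surj A"
    and "calm (\<lambda>u. f u - A u) x < sur A"
  shows "CARD('n) \<ge> CARD('m)
    \<and> lopen f x \<ge> sur A - calm (\<lambda>u. f u - A u) x
    \<and> sur A - calm (\<lambda>u. f u - A u) x > 0"
proof (intro conjI)
  have "dim (range A) \<le> dim (UNIV :: (real ^ 'n) set)"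
    by (rule dim_image_le[OF \<open>linear A\<close>])
  then show "CARD('m) \<le> CARD('n)" using \<open>surj A\<close> by simp
  show "sur A - calm (\<lambda>u. f u - A u) x \<le> lopen f x"
    using assms lopen_ge_sur_minus_calm by blast
  show "0 < sur A - calm (\<lambda>u. f u - A u) x"
    using assms(4) calm_nonneg[of "\<lambda>u. f u - A u" x]
    by (simp add: ereal_diff_gr0)
qed

end
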